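(* Let $n\ge2$ be an integer, and let $r_0>0$, $h_0<0$ and $r_0'\in(0,-h_0/r_0)$ be constants. Let $r(h)$ be the unique (maximally extended) solution of \[ \frac{r''}{1+r'^2}=(n-1)\left[\frac1r-\frac{1+r'^2}{r-hr'}\right] \] satisfying the initial conditions $r(h_0)=r_0$ and $r'(h_0)=r_0'$. Then $r(h)$ is an entire solution (it is defined for all $h\in\mathbb{R}$), and there are constants $0<r_{bot}<r_{top}<\infty$ such that: $r(h)$ is strictly increasing, $\lim_{h\to-\infty}r(h)=r_{bot}$, $\lim_{h\to\infty}r(h)=r_{top}$, and there exists a point $h_1\in(h_0,0)$ such that $r''(h_1)=0$ and $r''(h)$ has the same sign as $h_1-h$ whenever $h\ne h_1$.
   Context: A solution of the differential equation on an interval is a twice differentiable function $r=r(h)>0$ with $r-hr'\neq0$ on the interval satisfying the equation there; primes denote $d/dh$. (The equation says that rotating the profile curve $(r(h),h)$ about the $h$-axis in $\mathbb{R}^{n+1}$ gives a hypersurface satisfying $-\langle\overrightarrow{H},X\rangle=\frac1C$ with $C=\frac1{n-1}$, where $X$ is the position vector and $\overrightarrow{H}$ the mean curvature vector, i.e. a homothetic expander for the inverse mean curvature flow.) *)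

theory Defs
  imports "HOL-Analysis.Analysis"
begin

text \<open>
  Derivatives are taken within \<open>I\<close>, hence one-sided at an endpoint belonging to \<open>I\<close>;
  nondegeneracy of \<open>I\<close> makes them unique. Only the values of \<open>r\<close> on \<open>I\<close> matter.
\<close>
definition expander_solution :: "nat \<Rightarrow> real set \<Rightarrow> (real \<Rightarrow> real) \<Rightarrow> bool" where
  "expander_solution n I r \<longleftrightarrow>
     is_interval I \<and> interior I \<noteq> {} \<and>
     (\<exists>r' r'' :: real \<Rightarrow> real. \<forall>h\<in>I.
        (r has_real_derivative r' h) (at h within I) \<and>
        (r' has_real_derivative r'' h) (at h within I) \<and>
        r h > 0 \<and> r h - h * r' h \<noteq> 0 \<and>
        r'' h / (1 + (r' h)\<^sup>2) =
          (real n - 1) * (1 / r h - (1 + (r' h)\<^sup>2) / (r h - h * r' h)))"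

definition maximal_expander_solution :: "nat \<Rightarrow> real set \<Rightarrow> (real \<Rightarrow> real) \<Rightarrow> bool" where
  "maximal_expander_solution n I r \<longleftrightarrow>
     expander_solution n I r \<and>
     (\<forall>J s. expander_solution n J s \<and> I \<subseteq> J \<and> (\<forall>h\<in>I. s h = r h) \<longrightarrow> J = I)"

definition maximal_expander_ivp ::
    "nat \<Rightarrow> real \<Rightarrow> real \<Rightarrow> real \<Rightarrow> real set \<Rightarrow> (real \<Rightarrow> real) \<Rightarrow> bool" where
  "maximal_expander_ivp n h0 r0 r0' I r \<longleftrightarrow>
     maximal_expander_solution n I r \<and> h0 \<in> I \<and> r h0 = r0 \<and>
     (r has_real_derivative r0') (at h0 within I)"

end

(*
  Put m = n - 1, p = r', u = h + r p and w = r - h p. The equation reads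
  r'' = - m (1 + p^2) p u / (r w). Since r'' is p times a continuous function, p stays positive, and
  u satisfies u' = (1 + p^2) - k u with k continuous, so u changes sign once, from negative to positive: at the
  inflection point h1, which lies left of 0 because u > 0 on [0, \<infinity>). This bounds p by -h0 / r0.
  Left of h0, the quantity ln (1 + p^2) / 2 - m ln r + c p is nondecreasing for a suitable c, which
  keeps r away from 0; right of 0, w is nondecreasing. Hence r and w are bounded below
  by a constant depending on the data only, every solution also solves an equation with globally
  Lipschitz (clamped) right-hand side, and global existence and uniqueness follow. For h \<ge> 1, the
  quantity ln r + r(1) p is nonincreasing, which bounds r above.
*)
theory Submission
  imports Defs
begin

subsection \<open>Global existence for Lipschitz equations\<close>

text \<open>Banach's fixed point theorem for the integral equation, in a space of continuous
  functions with a weighted sup norm. The Lipschitz constant \<open>l\<close> may grow with time; a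
  weight built from its antiderivative \<open>L\<close> gives a contraction on the whole line, so no
  local solutions have to be continued.\<close>

lemma Picard_Lindelof_global:
  fixes f :: "real \<Rightarrow> 'a::euclidean_space \<Rightarrow> 'a" and l L :: "real \<Rightarrow> real"
  assumes cont: "continuous_on UNIV (\<lambda>(t, x). f t x)"
    and L: "\<And>t. (L has_real_derivative l t) (at t)" "L t0 = 0"
    and lip: "\<And>t x y. norm (f t x - f t y) \<le> l t * norm (x - y)"
    and growth: "\<And>t. norm (f t x0) \<le> M * l t"
  obtains x where "x t0 = x0" "\<And>t. (x has_vector_derivative f t (x t)) (at t)"
proof -
  \<comment> \<open>A basis vector and 0 are at distance 1, which turns \<open>lip\<close> into
    nonnegativity of \<open>l\<close>.\<close>
  obtain b :: 'a where "b \<in> Basis" using nonempty_Basis by blast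
  hence l_nonneg: "l t \<ge> 0" for t
    using order_trans[OF norm_ge_zero lip, of t b 0] by simp
  have contL: "continuous_on UNIV L"
    by (meson DERIV_isCont L(1) continuous_at_imp_continuous_on)
  have L_pos: "L t \<ge> 0" if "t \<ge> t0" for t
    using DERIV_nonneg_imp_nondecreasing[of t0 t L] that L l_nonneg by auto
  have L_neg: "L t \<le> 0" if "t \<le> t0" for t
    using DERIV_nonneg_imp_nondecreasing[of t t0 L] that L l_nonneg by auto
  \<comment> \<open>\<open>cosh (2 * L t)\<close> replaces the more common weight
    \<open>exp (2 * \<bar>L t\<bar>)\<close>: it is differentiable also at \<open>t0\<close>, and
    \<open>l * W\<close> has the explicit antiderivative \<open>S / 2\<close>, bounded by
    \<open>W / 2\<close>.\<close>
  define W where "W t = cosh (2 * L t)" for t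
  define S where "S t = sinh (2 * L t)" for t
  have dS: "(S has_real_derivative 2 * l t * W t) (at t)" for t
    unfolding S_def W_def by (auto intro!: derivative_eq_intros L)
  have W_ge: "1 \<le> W t" for t by (simp add: W_def cosh_real_ge_1)
  have contW: "continuous_on A W" for A
    unfolding W_def cosh_field_def by (intro continuous_intros continuous_on_subset[OF contL]) auto
  have contS: "continuous_on A S" for A
    unfolding S_def sinh_field_def by (intro continuous_intros continuous_on_subset[OF contL]) auto
  have S_le: "\<bar>S t\<bar> \<le> W t" for t
    using sinh_le_cosh_real[of "2 * L t"] sinh_le_cosh_real[of "- (2 * L t)"]
    by (simp add: S_def W_def)
  \<comment> \<open>In the norm weighted by \<open>1 / W\<close>, integration against \<open>l\<close> has norm at most 1/2.\<close>
  have bound: "norm (G t) \<le> D / 2 * W t"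
    if G: "\<And>s. (G has_vector_derivative g s) (at s)" "G t0 = 0"
      and g: "\<And>s. norm (g s) \<le> D * l s * W s" and D: "D \<ge> 0" for G and g :: "real \<Rightarrow> 'a" and D t
  proof -
    have d: "((\<lambda>s. D / 2 * S s) has_vector_derivative D * l s * W s) (at s)" for s
      unfolding has_real_derivative_iff_has_vector_derivative[symmetric]
      by (auto intro!: derivative_eq_intros dS)
    have contG: "continuous_on A G" for A
      by (meson G(1) continuous_at_imp_continuous_on has_vector_derivative_continuous)
    have *: "norm (G b - G a) \<le> D / 2 * S b - D / 2 * S a" if "a \<le> b" for a b
    proof (cases "a = b")
      case False
      with that show ?thesis
        by (intro differentiable_bound_general[where f' = g and \<phi>' = "\<lambda>s. D * l s * W s"]
            continuous_intros contG contS G d g) auto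
    qed auto
    have "norm (G t) \<le> D / 2 * \<bar>S t\<bar>"
    proof (cases "t0 \<le> t")
      case True
      thus ?thesis using *[OF True] D by (simp add: G L(2) S_def L_pos)
    next
      case False
      thus ?thesis using *[of t t0] D by (simp add: G L(2) S_def L_neg)
    qed
    also have "\<dots> \<le> D / 2 * W t" using S_le D by (intro mult_left_mono) auto
    finally show ?thesis .
  qed
  \<comment> \<open>An operator \<open>prim\<close> picks for each continuous function its primitive
    vanishing at \<open>t0\<close>; it plays the role of the signed integral from \<open>t0\<close>.
    Continuity is a premise under the existential quantifier so that choice yields a total
    operator.\<close>
  have "\<forall>g :: real \<Rightarrow> 'a. \<exists>G. continuous_on UNIV g \<longrightarrow>
      G t0 = 0 \<and> (\<forall>t. (G has_vector_derivative g t) (at t))"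
  proof (intro allI)
    fix g :: "real \<Rightarrow> 'a"
    show "\<exists>G. continuous_on UNIV g \<longrightarrow> G t0 = 0 \<and> (\<forall>t. (G has_vector_derivative g t) (at t))"
    proof (cases "continuous_on UNIV g")
      case True
      hence "\<exists>F. \<forall>x. (F has_vector_derivative g x) (at x)"
        using einterval_antiderivative[of "-\<infinity>" "\<infinity>" g]
        by (auto simp: continuous_on_eq_continuous_at)
      then obtain F where F: "\<And>x. (F has_vector_derivative g x) (at x)" by blast
      have "((\<lambda>t. F t - F t0) has_vector_derivative g x) (at x)" for x
        using has_vector_derivative_diff[OF F[of x] has_vector_derivative_const[of "F t0"]] by simp
      thus ?thesis by (intro exI[of _ "\<lambda>t. F t - F t0"]) auto
    qed auto
  qed
  from choice[OF this] obtain prim :: "(real \<Rightarrow> 'a) \<Rightarrow> real \<Rightarrow> 'a"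
    where prim: "\<And>g. continuous_on UNIV g \<Longrightarrow> prim g t0 = 0"
      "\<And>g t. continuous_on UNIV g \<Longrightarrow> (prim g has_vector_derivative g t) (at t)"
    by blast
  \<comment> \<open>A bounded continuous \<open>z\<close> encodes the trajectory \<open>X z\<close>
    through the rescaled deviation \<open>z = (X z - x0) / W\<close>.\<close>
  define X where "X z t = x0 + W t *\<^sub>R apply_bcontfun z t" for z :: "real \<Rightarrow>\<^sub>C 'a" and t
  define R where "R z t = f t (X z t)" for z t
  have contR: "continuous_on UNIV (R z)" for z
  proof -
    have "continuous_on UNIV (\<lambda>t. (t, X z t))"
      unfolding X_def by (intro continuous_intros contW) auto
    from continuous_on_compose2[OF cont this] show ?thesis by (simp add: R_def[abs_def])
  qed
  have R_bound: "norm (R z t) \<le> (norm z + \<bar>M\<bar>) * l t * W t" for z t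
  proof -
    have "norm (R z t) \<le> norm (R z t - f t x0) + norm (f t x0)"
      using norm_triangle_ineq[of "R z t - f t x0" "f t x0"] by simp
    also have "\<dots> \<le> l t * norm (W t *\<^sub>R z t) + M * l t"
      using lip[of t "X z t" x0] growth[of t] by (simp add: R_def X_def)
    also have "\<dots> \<le> l t * (W t * norm z) + \<bar>M\<bar> * l t * W t"
    proof (intro add_mono mult_left_mono l_nonneg)
      show "norm (W t *\<^sub>R z t) \<le> W t * norm z"
        using W_ge[of t] norm_bounded[of z t] by (auto intro: mult_left_mono)
      have "M * l t \<le> \<bar>M\<bar> * l t * 1" using l_nonneg[of t] by (simp add: mult_right_mono)
      also have "\<dots> \<le> \<bar>M\<bar> * l t * W t" using W_ge l_nonneg by (intro mult_left_mono) auto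
      finally show "M * l t \<le> \<bar>M\<bar> * l t * W t" .
    qed
    finally show ?thesis by (simp add: algebra_simps)
  qed
  \<comment> \<open>The Picard operator in the rescaled variable. By \<open>R_bound\<close> and
    \<open>bound\<close> its values are bounded functions; the same \<open>bound\<close> applied to
    differences gives the contraction factor 1/2.\<close>
  define T where "T z = Bcontfun (\<lambda>t. (1 / W t) *\<^sub>R prim (R z) t)" for z
  have T: "apply_bcontfun (T z) t = (1 / W t) *\<^sub>R prim (R z) t" for z t
  proof -
    have "(\<lambda>t. (1 / W t) *\<^sub>R prim (R z) t) \<in> bcontfun"
    proof (rule bcontfun_normI)
      have "continuous_on UNIV (prim (R z))"
        by (meson prim(2) contR continuous_at_imp_continuous_on has_vector_derivative_continuous)
      thus "continuous_on UNIV (\<lambda>t. (1 / W t) *\<^sub>R prim (R z) t)"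
        using W_ge by (intro continuous_intros contW) (auto simp: W_def)
      show "norm ((1 / W t) *\<^sub>R prim (R z) t) \<le> (norm z + \<bar>M\<bar>) / 2" for t
        using bound[OF prim(2,1)[OF contR] R_bound, of z t] W_ge[of t] by (simp add: field_simps)
    qed
    thus ?thesis by (simp add: T_def Bcontfun_inverse)
  qed
  have "dist (T z) (T y) \<le> 1/2 * dist z y" for z y
  proof (rule dist_bound)
    fix t
    have "norm (prim (R z) t - prim (R y) t) \<le> dist z y / 2 * W t"
    proof (rule bound)
      show "((\<lambda>t. prim (R z) t - prim (R y) t) has_vector_derivative R z s - R y s) (at s)" for s
        by (intro has_vector_derivative_diff prim contR)
      show "norm (R z s - R y s) \<le> dist z y * l s * W s" for s
      proof -
        have "norm (R z s - R y s) \<le> l s * (W s * dist (z s) (y s))"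
          using lip[of s "X z s" "X y s"] W_ge[of s]
          by (simp add: R_def X_def dist_norm scaleR_diff_right[symmetric])
        also have "\<dots> \<le> l s * (W s * dist z y)"
          using W_ge[of s] l_nonneg[of s] dist_bounded[of z s y]
          by (intro mult_left_mono) auto
        finally show ?thesis by (simp add: mult_ac)
      qed
    qed (auto simp: prim contR)
    moreover have "dist (T z t) (T y t) = norm (prim (R z) t - prim (R y) t) / W t"
      using W_ge[of t] by (simp add: T dist_norm scaleR_diff_right[symmetric])
    ultimately show "dist (T z t) (T y t) \<le> 1/2 * dist z y"
      using W_ge[of t] by (simp add: pos_divide_le_eq)
  qed
  then obtain z where z: "T z = z" using banach_fix_type[of "1/2" T] by auto
  have X: "X z t = x0 + prim (R z) t" for t
    using T[of z t] W_ge[of t] unfolding z X_def by simp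
  show thesis
  proof (rule that[of "X z"])
    show "X z t0 = x0" by (simp add: X prim contR)
    show "(X z has_vector_derivative f t (X z t)) (at t)" for t
      using has_vector_derivative_add[OF has_vector_derivative_const[of x0] prim(2)[OF contR, of z t]]
      by (simp add: X[abs_def] R_def)
  qed
qed

subsection \<open>A priori estimates\<close>

lemma interval_Icc_subset: "is_interval I \<Longrightarrow> a \<in> I \<Longrightarrow> b \<in> I \<Longrightarrow> {a..b} \<subseteq> (I :: real set)"
  by (meson atLeastAtMost_iff mem_is_interval_1_I subsetI)

lemma interval_has_derivative_at:
  fixes f :: "real \<Rightarrow> real"
  assumes "is_interval I" "a \<in> I" "b \<in> I" "a < x" "x < b" "(f has_real_derivative D) (at x within I)"
  shows "(f has_real_derivative D) (at x)"
proof -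
  have "(f has_real_derivative D) (at x within {a..b})"
    using DERIV_subset[OF assms(6) interval_Icc_subset[OF assms(1-3)]] .
  thus ?thesis using assms(4,5) by (simp add: at_within_Icc_at)
qed

lemma interval_continuous_on_Icc:
  fixes f :: "real \<Rightarrow> real"
  assumes "is_interval I" "a \<in> I" "b \<in> I"
    and "\<And>x. x \<in> I \<Longrightarrow> (f has_real_derivative f' x) (at x within I)"
  shows "continuous_on {a..b} f"
  using continuous_on_subset[OF DERIV_continuous_on interval_Icc_subset] assms by metis

lemma interval_derivative_mono:
  fixes f :: "real \<Rightarrow> real"
  assumes I: "is_interval I" "a \<in> I" "b \<in> I" and "a \<le> b"
    and df: "\<And>x. x \<in> I \<Longrightarrow> (f has_real_derivative f' x) (at x within I)"
    and f': "\<And>x. x \<in> I \<Longrightarrow> a < x \<Longrightarrow> x < b \<Longrightarrow> 0 \<le> f' x"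
  shows "f a \<le> f b"
proof (rule DERIV_nonneg_imp_increasing_open[OF \<open>a \<le> b\<close>])
  show "\<exists>y. DERIV f x :> y \<and> 0 \<le> y" if x: "a < x" "x < b" for x
  proof -
    have "x \<in> I" using interval_Icc_subset[OF I] x by auto
    thus ?thesis using interval_has_derivative_at[OF I x df] f' x by blast
  qed
  show "continuous_on {a..b} f"
    using interval_continuous_on_Icc[OF I df] .
qed

lemma interval_derivative_strict_mono:
  fixes f :: "real \<Rightarrow> real"
  assumes I: "is_interval I" "a \<in> I" "b \<in> I" and "a < b"
    and df: "\<And>x. x \<in> I \<Longrightarrow> (f has_real_derivative f' x) (at x within I)"
    and f': "\<And>x. x \<in> I \<Longrightarrow> a < x \<Longrightarrow> x < b \<Longrightarrow> 0 < f' x"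
  shows "f a < f b"
proof (rule DERIV_pos_imp_increasing_open[OF \<open>a < b\<close>])
  show "\<exists>y. DERIV f x :> y \<and> 0 < y" if x: "a < x" "x < b" for x
  proof -
    have "x \<in> I" using interval_Icc_subset[OF I] x by auto
    thus ?thesis using interval_has_derivative_at[OF I x df] f' x by blast
  qed
  show "continuous_on {a..b} f"
    using interval_continuous_on_Icc[OF I df] .
qed

text \<open>\<open>E\<close> is the exponential of minus an antiderivative of \<open>k\<close>. If
  \<open>f' = g + k * f\<close>, then \<open>(E * f)' = E * g\<close>, and \<open>E * f\<close> has
  the same sign as \<open>f\<close>.\<close>

lemma integrating_factor:
  fixes k :: "real \<Rightarrow> real"
  assumes "continuous_on {a..b} k"
  obtains E where "\<And>x. 0 < E x"
    "\<And>x. x \<in> {a..b} \<Longrightarrow> (E has_real_derivative - k x * E x) (at x within {a..b})"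
proof -
  obtain K where K: "\<And>x. x \<in> {a..b} \<Longrightarrow> (K has_vector_derivative k x) (at x within {a..b})"
    using antiderivative_continuous[OF assms] by blast
  show thesis
    by (rule that[of "\<lambda>x. exp (- K x)"])
      (auto intro!: derivative_eq_intros K[folded has_real_derivative_iff_has_vector_derivative])
qed

section \<open>Normal form of the equation and estimates for its solutions\<close>

definition expander_rhs :: "real \<Rightarrow> real \<Rightarrow> real \<Rightarrow> real \<Rightarrow> real" where
  "expander_rhs m h r p = - m * (1 + p\<^sup>2) * p * (h + r * p) / (r * (r - h * p))"

text \<open>Here \<open>m\<close> stands for \<open>n - 1\<close>. The condition
  \<open>u0_neg\<close> is \<open>p0 < - h0 / r0\<close> with the denominator cleared.\<close>

locale expander_data =
  fixes m h0 r0 p0 :: real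
  assumes m_ge: "m \<ge> 1" and r0_pos: "r0 > 0" and h0_neg: "h0 < 0" and p0_pos: "p0 > 0"
    and u0_neg: "h0 + r0 * p0 < 0"
begin

definition P :: real where "P = - h0 / r0"

text \<open>This is \<open>exp (- \<Psi> h0 / m)\<close> for the monotone quantity
  \<open>\<Psi>\<close> of \<open>r_ge_\<rho>_left\<close>; it depends on the initial data
  only.\<close>

definition \<rho> :: real where
  "\<rho> = exp (- (ln (1 + p0\<^sup>2) / 2 - m * ln r0 + r0 / - (h0 + r0 * p0) * p0) / m)"

lemma \<rho>_pos: "\<rho> > 0" by (simp add: \<rho>_def)

lemma p0_less_P: "p0 < P"
  using u0_neg r0_pos by (simp add: P_def field_simps)

end

text \<open>A solution on any interval containing \<open>h0\<close>. The equation only asks for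
  \<open>r - h * p\<close> to be nonzero; the positive sign is the one it has at \<open>h0\<close>,
  where \<open>h0 < 0 < p0\<close>.\<close>

locale expander_curve = expander_data +
  fixes I :: "real set" and r p :: "real \<Rightarrow> real"
  assumes interval: "is_interval I" and h0_in: "h0 \<in> I" and r_h0: "r h0 = r0" and p_h0: "p h0 = p0"
    and dr: "h \<in> I \<Longrightarrow> (r has_real_derivative p h) (at h within I)"
    and dp: "h \<in> I \<Longrightarrow> (p has_real_derivative expander_rhs m h (r h) (p h)) (at h within I)"
    and r_pos: "h \<in> I \<Longrightarrow> 0 < r h"
    and w_pos: "h \<in> I \<Longrightarrow> 0 < r h - h * p h"
begin

definition u :: "real \<Rightarrow> real" where "u h = h + r h * p h"

lemma cont_r: "continuous_on I r" and cont_p: "continuous_on I p"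
  by (rule DERIV_continuous_on, erule dr) (rule DERIV_continuous_on, erule dp)

lemma u_h0: "u h0 < 0"
  using u0_neg by (simp add: u_def r_h0 p_h0)

text \<open>The right-hand side is \<open>k * p\<close> with \<open>k\<close> continuous along the
  curve. Hence \<open>E * p\<close> is constant for the integrating factor \<open>E\<close>, and
  \<open>p\<close> keeps its initial sign.\<close>

lemma p_pos:
  assumes "x \<in> I" shows "0 < p x"
proof -
  define a b where "a = min x h0" and "b = max x h0"
  have ab: "a \<in> I" "b \<in> I" "a \<le> b" using assms h0_in by (auto simp: a_def b_def min_def max_def)
  have sub: "{a..b} \<subseteq> I" using interval_Icc_subset[OF interval ab(1,2)] .
  define k where "k h = - m * (1 + (p h)\<^sup>2) * (h + r h * p h) / (r h * (r h - h * p h))" for h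
  have "continuous_on I k"
    unfolding k_def using r_pos w_pos by (intro continuous_intros cont_r cont_p) fastforce+
  then obtain E where E: "\<And>x. 0 < E x"
    "\<And>x. x \<in> {a..b} \<Longrightarrow> (E has_real_derivative - k x * E x) (at x within {a..b})"
    using integrating_factor[OF continuous_on_subset[OF _ sub]] by blast
  have "((\<lambda>h. E h * p h) has_real_derivative 0) (at h within {a..b})" if "h \<in> {a..b}" for h
  proof -
    have "expander_rhs m h (r h) (p h) = k h * p h"
      by (simp add: expander_rhs_def k_def mult_ac)
    hence "(p has_real_derivative k h * p h) (at h within {a..b})"
      using DERIV_subset[OF dp sub, of h] that sub by auto
    from DERIV_mult[OF E(2)[OF that] this] show ?thesis by simp
  qed
  then obtain c where "\<forall>h\<in>{a..b}. E h * p h = c"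
    using has_field_derivative_zero_constant[of "{a..b}" "\<lambda>h. E h * p h"] by auto
  moreover have "x \<in> {a..b}" "h0 \<in> {a..b}" by (auto simp: a_def b_def)
  ultimately have "E x * p x = E h0 * p0" by (metis p_h0)
  thus ?thesis using E(1)[of x] E(1)[of h0] p0_pos by (metis mult_pos_pos zero_less_mult_pos)
qed

lemma r_strict_mono: "a \<in> I \<Longrightarrow> b \<in> I \<Longrightarrow> a < b \<Longrightarrow> r a < r b"
  using interval_derivative_strict_mono[OF interval _ _ _ dr] p_pos by blast

lemma r_mono: "a \<in> I \<Longrightarrow> b \<in> I \<Longrightarrow> a \<le> b \<Longrightarrow> r a \<le> r b"
  using r_strict_mono[of a b] by force

text \<open>
  The function \<open>u\<close> satisfies a linear equation \<open>u' = (1 + p\<^sup>2) - k u\<close> with positive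
  inhomogeneity, so it can only change sign from negative to positive.
\<close>
lemma u_crossing:
  assumes ab: "a \<in> I" "b \<in> I" "a < b" and "0 \<le> u a"
  shows "0 < u b"
proof -
  have sub: "{a..b} \<subseteq> I" using interval_Icc_subset[OF interval ab(1,2)] .
  define k where "k h = - m * p h * (1 + (p h)\<^sup>2) / (r h - h * p h)" for h
  have "continuous_on I k"
    unfolding k_def using w_pos by (intro continuous_intros cont_r cont_p) fastforce+
  then obtain E where E: "\<And>x. 0 < E x"
    "\<And>x. x \<in> {a..b} \<Longrightarrow> (E has_real_derivative - k x * E x) (at x within {a..b})"
    using integrating_factor[OF continuous_on_subset[OF _ sub]] by blast
  have du: "((\<lambda>h. E h * u h) has_real_derivative E h * (1 + (p h)\<^sup>2)) (at h within {a..b})"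
    if "h \<in> {a..b}" for h
  proof -
    have h: "h \<in> I" using that sub by blast
    \<comment> \<open>In \<open>u' = 1 + p^2 + r * p'\<close> the factor \<open>r\<close> cancels
      the one in the denominator of \<open>p'\<close>, which leaves \<open>k * u\<close>.\<close>
    have "r h * (- m * (1 + (p h)\<^sup>2) * p h * (h + r h * p h) / (r h * (r h - h * p h))) = k h * u h"
      using r_pos[OF h] by (simp add: k_def u_def)
    moreover have "(u has_real_derivative 1 + (p h * p h +
        r h * expander_rhs m h (r h) (p h))) (at h within {a..b})"
      unfolding u_def[abs_def]
      by (rule derivative_eq_intros DERIV_subset[OF dr sub] DERIV_subset[OF dp sub] h refl)+ simp
    ultimately have "(u has_real_derivative 1 + (p h)\<^sup>2 + k h * u h) (at h within {a..b})"
      by (simp add: expander_rhs_def power2_eq_square add_ac)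
    from DERIV_mult[OF E(2)[OF that] this] show ?thesis by (simp add: algebra_simps)
  qed
  have "E a * u a < E b * u b"
  proof (rule interval_derivative_strict_mono[of "{a..b}" a b "\<lambda>h. E h * u h"
        "\<lambda>h. E h * (1 + (p h)\<^sup>2)"])
    show "0 < E x * (1 + (p x)\<^sup>2)" for x
      using E(1)[of x] by (simp add: add_pos_nonneg)
  qed (use du \<open>a < b\<close> in \<open>auto simp: is_interval_cc\<close>)
  moreover have "0 \<le> E a * u a" using E(1)[of a] \<open>0 \<le> u a\<close> by simp
  ultimately have "0 < E b * u b" by linarith
  thus ?thesis using E(1)[of b] zero_less_mult_pos by blast
qed

text \<open>All factors of the right-hand side other than \<open>- u\<close> are positive.\<close>

lemma sgn_p': assumes "h \<in> I" shows "sgn (expander_rhs m h (r h) (p h)) = - sgn (u h)"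
proof -
  define K where "K = m * (1 + (p h)\<^sup>2) * p h / (r h * (r h - h * p h))"
  have "expander_rhs m h (r h) (p h) = - K * u h"
    by (simp add: expander_rhs_def u_def K_def)
  moreover have "0 < K"
    using assms m_ge p_pos r_pos w_pos by (simp add: K_def add_pos_nonneg)
  ultimately show ?thesis by (simp add: sgn_mult)
qed

lemma p'_nonneg: "h \<in> I \<Longrightarrow> u h \<le> 0 \<Longrightarrow> 0 \<le> expander_rhs m h (r h) (p h)"
  and p'_nonpos: "h \<in> I \<Longrightarrow> 0 \<le> u h \<Longrightarrow> expander_rhs m h (r h) (p h) \<le> 0"
  using sgn_p'[of h] by (auto simp: sgn_if split: if_splits)

lemma u_neg: "h \<in> I \<Longrightarrow> h \<le> h0 \<Longrightarrow> u h < 0"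
  using u_crossing[OF _ h0_in] u_h0 by (cases "h = h0") force+

lemma p_mono_left: assumes "a \<in> I" "b \<in> I" "a \<le> b" "b \<le> h0" shows "p a \<le> p b"
proof (rule interval_derivative_mono[OF interval assms(1-3) dp])
  show "0 \<le> expander_rhs m x (r x) (p x)" if "x \<in> I" "a < x" "x < b" for x
    using p'_nonneg u_neg[of x] that assms by simp
qed

lemma p_antimono: assumes "a \<in> I" "b \<in> I" "a \<le> b" "0 \<le> u a" shows "p b \<le> p a"
proof -
  have "- p a \<le> - p b"
  proof (rule interval_derivative_mono[OF interval assms(1-3) DERIV_minus[OF dp]])
    show "0 \<le> - expander_rhs m x (r x) (p x)" if "x \<in> I" "a < x" "x < b" for x
      using p'_nonpos u_crossing[of a x] that assms by simp
  qed
  thus ?thesis by simp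
qed

text \<open>The slope grows while \<open>u \<le> 0\<close> and falls afterwards. Right of
  \<open>h0\<close>, as long as \<open>u \<le> 0\<close>, one has
  \<open>r0 * p \<le> r * p \<le> - h \<le> - h0\<close>; beyond the zero of \<open>u\<close> the
  slope at that zero is an upper bound.\<close>

lemma p_le_P: assumes h: "h \<in> I" shows "p h \<le> P"
proof (cases "h \<le> h0")
  case True
  thus ?thesis using p_mono_left[OF h h0_in] p0_less_P p_h0 by simp
next
  case False
  have *: "p c \<le> P" if c: "c \<in> I" "h0 \<le> c" and "u c \<le> 0" for c
  proof -
    have "r0 * p c \<le> r c * p c"
      using r_mono[OF h0_in c] p_pos[OF c(1)] r_h0 by simp
    also have "\<dots> \<le> - h0" using that by (simp add: u_def)
    finally show ?thesis using r0_pos by (simp add: P_def field_simps)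
  qed
  show ?thesis
  proof (cases "u h \<le> 0")
    case True
    thus ?thesis using * h False by simp
  next
    case uh: False
    have sub: "{h0..h} \<subseteq> I" using interval_Icc_subset[OF interval h0_in h] .
    have "continuous_on {h0..h} u"
      unfolding u_def[abs_def]
      by (intro continuous_intros continuous_on_subset[OF cont_r sub] continuous_on_subset[OF cont_p sub])
    then obtain c where c: "h0 \<le> c" "c \<le> h" "u c = 0"
      using IVT'[of u h0 0 h] u_h0 uh False by auto
    hence "c \<in> I" using sub by auto
    thus ?thesis using p_antimono[of c h] *[of c] c h by simp
  qed
qed

text \<open>
  Left of \<open>h0\<close> the function \<open>ln (1 + p\<^sup>2) / 2 - m ln r + c p\<close>, where \<open>c = r0 / - u h0\<close>,
  is nondecreasing: the derivative of the first two terms is \<open>- m p (1 + p\<^sup>2) / (r - h p)\<close>,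
  which is \<open>- p'\<close> times \<open>r / - u \<le> c\<close>.
\<close>
lemma r_ge_\<rho>_left: assumes h: "h \<in> I" "h \<le> h0" shows "\<rho> \<le> r h"
proof -
  define \<delta> where "\<delta> = - (h0 + r0 * p0)"
  have \<delta>: "\<delta> > 0" using u0_neg by (simp add: \<delta>_def)
  define \<Psi> where "\<Psi> x = ln (1 + (p x)\<^sup>2) / 2 - m * ln (r x) + r0 / \<delta> * p x" for x
  let ?F = "\<lambda>x. expander_rhs m x (r x) (p x)"
  have "\<Psi> h \<le> \<Psi> h0"
  proof (rule interval_derivative_mono[OF interval h(1) h0_in h(2),
        where f' = "\<lambda>x. p x * ?F x / (1 + (p x)\<^sup>2) - m * (p x / r x) + r0 / \<delta> * ?F x"])
    fix x assume x: "x \<in> I"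
    have pos2: "1 + (p x)\<^sup>2 > 0" by (simp add: add_pos_nonneg)
    hence "((\<lambda>x. ln (1 + (p x)\<^sup>2)) has_real_derivative 2 * (p x * ?F x / (1 + (p x)\<^sup>2))) (at x within I)"
      by (auto intro!: derivative_eq_intros dp x)
    hence "((\<lambda>x. ln (1 + (p x)\<^sup>2) / 2) has_real_derivative p x * ?F x / (1 + (p x)\<^sup>2)) (at x within I)"
      by (rule DERIV_cong[OF DERIV_cdivide[of _ _ _ _ 2]]) (rule nonzero_mult_div_cancel_left, simp)
    note d1 = this
    have d2: "((\<lambda>x. m * ln (r x)) has_real_derivative m * (p x / r x)) (at x within I)"
      using r_pos[OF x] by (auto intro!: derivative_eq_intros dr x)
    show "(\<Psi> has_real_derivative p x * ?F x / (1 + (p x)\<^sup>2) - m * (p x / r x) + r0 / \<delta> * ?F x)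
        (at x within I)"
      unfolding \<Psi>_def by (rule DERIV_add[OF DERIV_diff[OF d1 d2] DERIV_cmult[OF dp[OF x]]])
    assume xh: "h < x" "x < h0"
    note pos = p_pos[OF x] r_pos[OF x] w_pos[OF x]
    \<comment> \<open>Left of \<open>h0\<close> both \<open>r\<close> and \<open>p\<close> are at
      most their initial values and \<open>- x\<close> exceeds \<open>- h0\<close>, so
      \<open>- u x\<close> is at least \<open>\<delta>\<close>. Together with
      \<open>r x \<le> r0\<close> this bounds \<open>r / - u\<close> by
      \<open>r0 / \<delta>\<close>.\<close>
    have r_le: "r x \<le> r0" using r_mono[OF x h0_in] xh r_h0 by simp
    have "r x * p x \<le> r0 * p0"
      using r_le p_mono_left[OF x h0_in] xh p_h0 pos r0_pos by (intro mult_mono) auto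
    hence u_le: "\<delta> \<le> - u x" using xh by (simp add: u_def \<delta>_def)
    define Q where "Q = m * p x * (1 + (p x)\<^sup>2) / (r x - x * p x)"
    have Q: "Q > 0" using pos m_ge by (simp add: Q_def add_pos_nonneg)
    have "p x * ?F x / (1 + (p x)\<^sup>2) = - m * (p x)\<^sup>2 * u x / (r x * (r x - x * p x))"
      using pos2 by (simp add: expander_rhs_def u_def power2_eq_square)
    also have "\<dots> - m * (p x / r x) = - Q"
      unfolding Q_def u_def using pos by (simp add: divide_simps) (simp add: power2_eq_square algebra_simps)
    finally have 1: "p x * ?F x / (1 + (p x)\<^sup>2) - m * (p x / r x) = - Q" .
    have "?F x = - (Q * (u x / r x))" by (simp add: expander_rhs_def u_def Q_def mult_ac)
    hence "?F x = Q * (- u x / r x)" by simp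
    moreover have "1 \<le> r0 / \<delta> * (- u x / r x)"
    proof -
      have "r x * \<delta> \<le> r0 * (- u x)" using r_le u_le pos \<delta> r0_pos by (intro mult_mono) auto
      thus ?thesis using pos \<delta> by (simp add: field_simps)
    qed
    hence "Q * 1 \<le> Q * (r0 / \<delta> * (- u x / r x))" using Q by (intro mult_left_mono) auto
    ultimately have "Q \<le> r0 / \<delta> * ?F x" by (simp add: mult_ac)
    thus "0 \<le> p x * ?F x / (1 + (p x)\<^sup>2) - m * (p x / r x) + r0 / \<delta> * ?F x" using 1 by linarith
  qed
  \<comment> \<open>Two of the three terms of \<open>\<Psi> h\<close> are nonnegative; dropping them
    leaves a lower bound for \<open>ln (r h)\<close>.\<close>
  moreover have "0 \<le> ln (1 + (p h)\<^sup>2)" by simp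
  moreover have "0 \<le> r0 / \<delta> * p h" using p_pos[OF h(1)] r0_pos \<delta> by simp
  ultimately have "- \<Psi> h0 \<le> m * ln (r h)" unfolding \<Psi>_def[of h] by argo
  hence "- \<Psi> h0 / m \<le> ln (r h)" using m_ge by (simp add: field_simps)
  hence "exp (- \<Psi> h0 / m) \<le> r h" using r_pos[OF h(1)] by (simp add: ln_ge_iff)
  thus ?thesis by (simp add: \<Psi>_def \<rho>_def \<delta>_def r_h0 p_h0)
qed

lemma r_ge_\<rho>: assumes h: "h \<in> I" shows "\<rho> \<le> r h"
  using r_ge_\<rho>_left[of h] r_ge_\<rho>_left[OF h0_in] r_mono[OF h0_in h] h by (cases "h \<le> h0") auto

lemma u_pos: "h \<in> I \<Longrightarrow> 0 \<le> h \<Longrightarrow> 0 < u h"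
  using r_pos p_pos by (simp add: u_def add_nonneg_pos)

text \<open>For \<open>h \<le> 0\<close> the term \<open>- h * p\<close> only helps. For
  \<open>h > 0\<close> the derivative of \<open>r - h * p\<close> is \<open>- h * p'\<close>,
  nonnegative because \<open>u > 0\<close> there, so the value \<open>r 0\<close> at 0 is a lower
  bound.\<close>

lemma w_ge_\<rho>: assumes h: "h \<in> I" shows "\<rho> \<le> r h - h * p h"
proof (cases "h \<le> 0")
  case True
  hence "h * p h \<le> 0" using p_pos[OF h] by (simp add: mult_nonpos_nonneg)
  thus ?thesis using r_ge_\<rho>[OF h] by simp
next
  case False
  hence z: "0 \<in> I" using interval_Icc_subset[OF interval h0_in h] h0_neg by auto
  have "r 0 - 0 * p 0 \<le> r h - h * p h"
  proof (rule interval_derivative_mono[OF interval z h, of "\<lambda>h. r h - h * p h"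
        "\<lambda>h. - h * expander_rhs m h (r h) (p h)"])
    fix x assume x: "x \<in> I"
    show "((\<lambda>h. r h - h * p h) has_real_derivative - x * expander_rhs m x (r x) (p x)) (at x within I)"
      by (auto intro!: derivative_eq_intros dr dp x)
    assume "0 < x" "x < h"
    thus "0 \<le> - x * expander_rhs m x (r x) (p x)"
      using p'_nonpos[OF x] u_pos[OF x] by (simp add: mult_nonneg_nonpos)
  qed (use False in auto)
  thus ?thesis using r_ge_\<rho>[OF z] by simp
qed

end

subsection \<open>The clamped equation\<close>

text \<open>Telescoping, one factor changed at a time. It serves the clamped right-hand side, which
  is a product of three factors.\<close>

lemma mult3_lipschitz:
  fixes a b c a' b' c' :: real
  assumes "\<bar>a'\<bar> \<le> A" "\<bar>b\<bar> \<le> B" "\<bar>b'\<bar> \<le> B" "\<bar>c\<bar> \<le> C"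
    and "\<bar>a - a'\<bar> \<le> A' * d" "\<bar>b - b'\<bar> \<le> B' * d" "\<bar>c - c'\<bar> \<le> C' * d"
    and nn: "0 \<le> A'" "0 \<le> B'" "0 \<le> d"
  shows "\<bar>a * b * c - a' * b' * c'\<bar> \<le> (A' * B * C + A * B' * C + A * B * C') * d"
proof -
  have "a * b * c - a' * b' * c' = (a - a') * b * c + a' * (b - b') * c + a' * b' * (c - c')"
    by (simp add: algebra_simps)
  also have "\<bar>\<dots>\<bar> \<le> \<bar>(a - a') * b * c\<bar> + \<bar>a' * (b - b') * c\<bar> + \<bar>a' * b' * (c - c')\<bar>"
    by linarith
  also have "\<dots> \<le> (A' * d) * B * C + A * (B' * d) * C + A * B * (C' * d)"
  proof -
    have nonneg: "0 \<le> A" "0 \<le> B" "0 \<le> A' * d" "0 \<le> B' * d"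
      using order_trans[OF abs_ge_zero assms(1)] order_trans[OF abs_ge_zero assms(2)] nn by simp_all
    show ?thesis
      unfolding abs_mult
      by (intro add_mono mult_mono mult_nonneg_nonneg assms nonneg abs_ge_zero)
  qed
  finally show ?thesis by (simp add: algebra_simps)
qed

lemma inverse_lipschitz:
  fixes x y c :: real
  assumes "c > 0" "c \<le> x" "c \<le> y"
  shows "\<bar>1 / x - 1 / y\<bar> \<le> 1 / c\<^sup>2 * \<bar>x - y\<bar>"
proof -
  have "\<bar>1 / x - 1 / y\<bar> = \<bar>x - y\<bar> / (x * y)"
    using assms by (simp add: divide_simps abs_mult abs_minus_commute)
  also have "\<dots> \<le> \<bar>x - y\<bar> / c\<^sup>2"
    unfolding power2_eq_square using assms by (intro divide_left_mono mult_mono mult_pos_pos) auto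
  finally show ?thesis by simp
qed

text \<open>The slope is truncated to \<open>[- 1, B]\<close>, and \<open>r\<close> and
  \<open>r - h * p\<close> are cut off below at \<open>c\<close>, which removes the singularities
  and the growth in \<open>p\<close>. Writing \<open>u / r\<close> as \<open>h / s + q\<close> makes
  each of the three factors globally Lipschitz in \<open>(r, p)\<close> for fixed
  \<open>h\<close>.\<close>

definition clamped_rhs :: "real \<Rightarrow> real \<Rightarrow> real \<Rightarrow> real \<Rightarrow> real \<Rightarrow> real \<Rightarrow> real" where
  "clamped_rhs m c B h r p =
     (let q = max (- 1) (min B p); s = max c r
      in - m * (q + q ^ 3) * (h / s + q) * (1 / max c (s - h * q)))"

lemma clamped_rhs_eq:
  assumes "c > 0" "- 1 \<le> p" "p \<le> B" "c \<le> r" "c \<le> r - h * p"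
  shows "clamped_rhs m c B h r p = expander_rhs m h r p"
proof -
  have "r > 0" using assms by linarith
  hence "h / r + p = (h + r * p) / r" by (simp add: field_simps)
  moreover have "p + p ^ 3 = (1 + p\<^sup>2) * p" by (simp add: algebra_simps power2_eq_square power3_eq_cube)
  ultimately show ?thesis
    using assms by (simp add: clamped_rhs_def expander_rhs_def Let_def max_absorb2 min_absorb2)
qed

text \<open>The bound of the second factor and the Lipschitz constants of the last two grow linearly
  in \<open>\<bar>h\<bar>\<close>, so the product rule gives quadratic growth. It is expressed by
  \<open>1 + 3 * h^2\<close> because this is the derivative of \<open>h + h ^ 3\<close>.\<close>

lemma clamped_rhs_bounds:
  assumes m: "m \<ge> 1" and c: "0 < c" and B: "B \<ge> 1"
  obtains K where "K > 0"
    "\<And>h r p r' p'. \<bar>clamped_rhs m c B h r p - clamped_rhs m c B h r' p'\<bar> \<le>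
        K * (1 + 3 * h\<^sup>2) * (\<bar>r - r'\<bar> + \<bar>p - p'\<bar>)"
    "\<And>h r p. \<bar>clamped_rhs m c B h r p\<bar> \<le> K * (1 + 3 * h\<^sup>2)"
proof -
  \<comment> \<open>\<open>A\<close>, \<open>D\<close>, \<open>G\<close> bound the factors
    \<open>al\<close>, \<open>be\<close>, \<open>ga\<close>, and \<open>A'\<close>,
    \<open>D'\<close>, \<open>G'\<close> are their Lipschitz constants; \<open>D\<close>,
    \<open>D'\<close> and \<open>G'\<close> come with an additional factor
    \<open>1 + \<bar>h\<bar>\<close>.\<close>
  define A where "A = m * (B + B ^ 3)"
  define A' where "A' = m * (1 + 3 * B\<^sup>2)"
  define D where "D = 1 / c + B"
  define D' where "D' = 1 / c\<^sup>2 + 1"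
  define G where "G = 1 / c"
  define G' where "G' = 1 / c\<^sup>2 * (1 + B)"
  have nn: "A > 0" "A' > 0" "D > 0" "D' > 0" "G > 0" "G' > 0"
    using m c B by (auto simp: A_def A'_def D_def D'_def G_def G'_def add_pos_pos)
  define al where "al p = - m * (p + p ^ 3)" for p :: real
  define q where "q p = max (- 1) (min B p)" for p :: real
  define s where "s r = max c r" for r :: real
  define be where "be h r p = h / s r + q p" for h r p
  define ga where "ga h r p = 1 / max c (s r - h * q p)" for h r p
  have F: "clamped_rhs m c B h r p = al (q p) * be h r p * ga h r p" for h r p
    by (simp add: clamped_rhs_def al_def q_def s_def be_def ga_def Let_def)
  have q: "\<bar>q p\<bar> \<le> B" "\<bar>q p - q p'\<bar> \<le> \<bar>p - p'\<bar>" for p p' using B by (auto simp: q_def)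
  have s: "c \<le> s r" "\<bar>s r - s r'\<bar> \<le> \<bar>r - r'\<bar>" for r r' by (auto simp: s_def)
  have al: "\<bar>al (q p)\<bar> \<le> A" for p
  proof -
    have "\<bar>q p + q p ^ 3\<bar> \<le> \<bar>q p\<bar> + \<bar>q p\<bar> ^ 3" using abs_triangle_ineq[of "q p" "q p ^ 3"] by (simp add: power_abs)
    also have "\<dots> \<le> B + B ^ 3" using q by (intro add_mono power_mono) auto
    finally show ?thesis using m by (simp add: al_def A_def abs_mult)
  qed
  have al': "\<bar>al (q p) - al (q p')\<bar> \<le> A' * \<bar>p - p'\<bar>" for p p'
  proof -
    let ?x = "q p" and ?y = "q p'"
    have "al ?x - al ?y = - m * ((1 + (?x\<^sup>2 + ?x * ?y + ?y\<^sup>2)) * (?x - ?y))"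
      by (simp add: al_def algebra_simps power2_eq_square power3_eq_cube)
    hence "\<bar>al ?x - al ?y\<bar> = m * (\<bar>1 + (?x\<^sup>2 + ?x * ?y + ?y\<^sup>2)\<bar> * \<bar>?x - ?y\<bar>)"
      using m by (simp add: abs_mult)
    also have "\<dots> \<le> m * ((1 + 3 * B\<^sup>2) * \<bar>p - p'\<bar>)"
    proof (intro mult_mono q)
      have "\<bar>?x\<^sup>2\<bar> \<le> B\<^sup>2" "\<bar>?y\<^sup>2\<bar> \<le> B\<^sup>2" "\<bar>?x * ?y\<bar> \<le> B\<^sup>2"
        unfolding power2_eq_square abs_mult using B by (intro mult_mono q(1); simp)+
      thus "\<bar>1 + (?x\<^sup>2 + ?x * ?y + ?y\<^sup>2)\<bar> \<le> 1 + 3 * B\<^sup>2" by linarith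
    qed (use m in auto)
    finally show ?thesis by (simp add: A'_def mult_ac)
  qed
  have be: "\<bar>be h r p\<bar> \<le> (1 + \<bar>h\<bar>) * D" for h r p
  proof -
    have "\<bar>be h r p\<bar> \<le> \<bar>h\<bar> / s r + \<bar>q p\<bar>"
      using abs_triangle_ineq[of "h / s r" "q p"] s(1)[of r] c by (simp add: be_def)
    also have "\<dots> \<le> \<bar>h\<bar> / c + B" using c s(1)[of r] q by (intro add_mono divide_left_mono) auto
    also have "\<dots> \<le> (1 + \<bar>h\<bar>) * D" using c B by (simp add: D_def algebra_simps)
    finally show ?thesis .
  qed
  have be': "\<bar>be h r p - be h r' p'\<bar> \<le> ((1 + \<bar>h\<bar>) * D') * (\<bar>r - r'\<bar> + \<bar>p - p'\<bar>)" for h r p r' p'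
  proof -
    have "be h r p - be h r' p' = h * (1 / s r - 1 / s r') + (q p - q p')"
      by (simp add: be_def algebra_simps)
    also have "\<bar>\<dots>\<bar> \<le> \<bar>h\<bar> * \<bar>1 / s r - 1 / s r'\<bar> + \<bar>q p - q p'\<bar>"
      using abs_triangle_ineq by (simp add: abs_mult[symmetric])
    also have "\<dots> \<le> \<bar>h\<bar> * (1 / c\<^sup>2 * \<bar>r - r'\<bar>) + \<bar>p - p'\<bar>"
    proof (intro add_mono mult_left_mono q)
      show "\<bar>1 / s r - 1 / s r'\<bar> \<le> 1 / c\<^sup>2 * \<bar>r - r'\<bar>"
        by (rule order_trans[OF inverse_lipschitz[OF c s(1) s(1)]]) (intro mult_left_mono s, simp)
    qed auto
    also have "\<dots> \<le> ((1 + \<bar>h\<bar>) * D') * \<bar>r - r'\<bar> + ((1 + \<bar>h\<bar>) * D') * \<bar>p - p'\<bar>"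
    proof (rule add_mono)
      have "\<bar>h\<bar> * (1 / c\<^sup>2) \<le> (1 + \<bar>h\<bar>) * D'" unfolding D'_def by (intro mult_mono) auto
      thus "\<bar>h\<bar> * (1 / c\<^sup>2 * \<bar>r - r'\<bar>) \<le> ((1 + \<bar>h\<bar>) * D') * \<bar>r - r'\<bar>"
        using mult_right_mono abs_ge_zero by (metis mult.assoc)
      have "1 * 1 \<le> (1 + \<bar>h\<bar>) * D'" unfolding D'_def by (intro mult_mono) auto
      thus "\<bar>p - p'\<bar> \<le> ((1 + \<bar>h\<bar>) * D') * \<bar>p - p'\<bar>"
        using mult_right_mono[of 1 "(1 + \<bar>h\<bar>) * D'" "\<bar>p - p'\<bar>"] by simp
    qed
    also have "\<dots> = ((1 + \<bar>h\<bar>) * D') * (\<bar>r - r'\<bar> + \<bar>p - p'\<bar>)" by (simp add: distrib_left)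
    finally show ?thesis .
  qed
  have ga: "\<bar>ga h r p\<bar> \<le> G" for h r p
    using c by (simp add: ga_def G_def divide_left_mono)
  have ga': "\<bar>ga h r p - ga h r' p'\<bar> \<le> ((1 + \<bar>h\<bar>) * G') * (\<bar>r - r'\<bar> + \<bar>p - p'\<bar>)" for h r p r' p'
  proof -
    have "\<bar>ga h r p - ga h r' p'\<bar> \<le> 1 / c\<^sup>2 * \<bar>max c (s r - h * q p) - max c (s r' - h * q p')\<bar>"
      unfolding ga_def by (rule inverse_lipschitz[OF c]) auto
    also have "\<dots> \<le> 1 / c\<^sup>2 * \<bar>(s r - s r') - h * (q p - q p')\<bar>"
      by (intro mult_left_mono) (auto simp: algebra_simps)
    also have "\<dots> \<le> 1 / c\<^sup>2 * (\<bar>r - r'\<bar> + \<bar>h\<bar> * \<bar>p - p'\<bar>)"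
    proof (intro mult_left_mono)
      have "\<bar>(s r - s r') - h * (q p - q p')\<bar> \<le> \<bar>s r - s r'\<bar> + \<bar>h\<bar> * \<bar>q p - q p'\<bar>"
        using abs_triangle_ineq4[of "s r - s r'" "h * (q p - q p')"] by (simp add: abs_mult)
      also have "\<dots> \<le> \<bar>r - r'\<bar> + \<bar>h\<bar> * \<bar>p - p'\<bar>" by (intro add_mono mult_left_mono q s) auto
      finally show "\<bar>(s r - s r') - h * (q p - q p')\<bar> \<le> \<bar>r - r'\<bar> + \<bar>h\<bar> * \<bar>p - p'\<bar>" .
    qed auto
    also have "\<dots> \<le> 1 / c\<^sup>2 * ((1 + B) * (1 + \<bar>h\<bar>) * (\<bar>r - r'\<bar> + \<bar>p - p'\<bar>))"
    proof (intro mult_left_mono)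
      have "\<bar>r - r'\<bar> + \<bar>h\<bar> * \<bar>p - p'\<bar> \<le> (1 + \<bar>h\<bar>) * (\<bar>r - r'\<bar> + \<bar>p - p'\<bar>)"
        by (simp add: algebra_simps)
      also have "\<dots> = 1 * ((1 + \<bar>h\<bar>) * (\<bar>r - r'\<bar> + \<bar>p - p'\<bar>))" by simp
      also have "\<dots> \<le> (1 + B) * ((1 + \<bar>h\<bar>) * (\<bar>r - r'\<bar> + \<bar>p - p'\<bar>))"
        using B by (intro mult_right_mono) auto
      finally show "\<bar>r - r'\<bar> + \<bar>h\<bar> * \<bar>p - p'\<bar> \<le> (1 + B) * (1 + \<bar>h\<bar>) * (\<bar>r - r'\<bar> + \<bar>p - p'\<bar>)"
        by (simp add: mult_ac)
    qed auto
    finally show ?thesis by (simp add: G'_def mult_ac)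
  qed
  have sq: "1 \<le> (1 + \<bar>h\<bar>)\<^sup>2" "1 + \<bar>h\<bar> \<le> (1 + \<bar>h\<bar>)\<^sup>2" "(1 + \<bar>h\<bar>)\<^sup>2 \<le> 2 * (1 + 3 * h\<^sup>2)" for h :: real
  proof -
    have "2 * (1 + 3 * h\<^sup>2) - (1 + \<bar>h\<bar>)\<^sup>2 = (1 - \<bar>h\<bar>)\<^sup>2 + 4 * h\<^sup>2"
      by (simp add: power2_diff power2_sum)
    also have "0 \<le> \<dots>" by simp
    finally show "(1 + \<bar>h\<bar>)\<^sup>2 \<le> 2 * (1 + 3 * h\<^sup>2)" by simp
  qed (auto simp: power2_sum)
  define N where "N = A' * D * G + A * D' * G + A * D * G'"
  have N: "N > 0" using nn by (simp add: N_def add_pos_pos)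
  \<comment> \<open>\<open>2 * N\<close> serves the Lipschitz estimate and
    \<open>2 * (A * D * G)\<close> the pointwise bound; the factors 2 come from the last inequality
    of \<open>sq\<close>.\<close>
  define K where "K = 2 * N + 2 * (A * D * G)"
  show thesis
  proof (rule that[of K])
    show "K > 0" using N nn by (simp add: K_def add_pos_pos)
    fix h r p r' p' :: real
    let ?d = "\<bar>r - r'\<bar> + \<bar>p - p'\<bar>"
    have "\<bar>clamped_rhs m c B h r p - clamped_rhs m c B h r' p'\<bar>
        \<le> (A' * ((1 + \<bar>h\<bar>) * D) * G + A * ((1 + \<bar>h\<bar>) * D') * G +
           A * ((1 + \<bar>h\<bar>) * D) * ((1 + \<bar>h\<bar>) * G')) * ?d"
      unfolding F
    proof (rule mult3_lipschitz[OF al be be ga _ be' ga'])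
      show "\<bar>al (q p) - al (q p')\<bar> \<le> A' * ?d"
        using al'[of p p'] nn by (smt (verit) mult_left_mono)
    qed (use nn in auto)
    also have "A' * ((1 + \<bar>h\<bar>) * D) * G + A * ((1 + \<bar>h\<bar>) * D') * G +
           A * ((1 + \<bar>h\<bar>) * D) * ((1 + \<bar>h\<bar>) * G')
       = (A' * D * G) * (1 + \<bar>h\<bar>) + (A * D' * G) * (1 + \<bar>h\<bar>) + (A * D * G') * (1 + \<bar>h\<bar>)\<^sup>2"
      by (simp add: power2_eq_square mult_ac)
    also have "\<dots> \<le> (A' * D * G) * (1 + \<bar>h\<bar>)\<^sup>2 + (A * D' * G) * (1 + \<bar>h\<bar>)\<^sup>2 + (A * D * G') * (1 + \<bar>h\<bar>)\<^sup>2"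
      using nn by (intro add_mono mult_left_mono sq) auto
    also have "\<dots> = N * (1 + \<bar>h\<bar>)\<^sup>2" by (simp add: N_def algebra_simps)
    also have "\<dots> \<le> N * (2 * (1 + 3 * h\<^sup>2))" using N by (intro mult_left_mono sq) auto
    also have "\<dots> = (2 * N) * (1 + 3 * h\<^sup>2)" by simp
    also have "\<dots> \<le> K * (1 + 3 * h\<^sup>2)" using nn by (intro mult_right_mono) (auto simp: K_def)
    finally show "\<bar>clamped_rhs m c B h r p - clamped_rhs m c B h r' p'\<bar> \<le> K * (1 + 3 * h\<^sup>2) * ?d"
      by (simp add: mult_right_mono)
  next
    fix h r p :: real
    have "\<bar>clamped_rhs m c B h r p\<bar> \<le> A * ((1 + \<bar>h\<bar>) * D) * G"
      unfolding F abs_mult using nn by (intro mult_mono al be ga) auto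
    also have "\<dots> = (A * D * G) * (1 + \<bar>h\<bar>)" by simp
    also have "\<dots> \<le> (A * D * G) * (2 * (1 + 3 * h\<^sup>2))"
      using nn sq[of h] by (intro mult_left_mono) auto
    also have "\<dots> = (2 * (A * D * G)) * (1 + 3 * h\<^sup>2)" by simp
    also have "\<dots> \<le> K * (1 + 3 * h\<^sup>2)" using N by (intro mult_right_mono) (auto simp: K_def)
    finally show "\<bar>clamped_rhs m c B h r p\<bar> \<le> K * (1 + 3 * h\<^sup>2)" .
  qed
qed

text \<open>The bound on \<open>D'\<close> makes \<open>D * exp (- K)\<close> nonincreasing and
  \<open>D * exp K\<close> nondecreasing. The first settles points right of \<open>a\<close>, the
  second points left of it.\<close>

lemma Gronwall_zero:
  fixes D D' k :: "real \<Rightarrow> real"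
  assumes I: "is_interval I" "a \<in> I" "b \<in> I"
    and dD: "\<And>x. x \<in> I \<Longrightarrow> (D has_real_derivative D' x) (at x within I)"
    and K: "\<And>x. (K has_real_derivative k x) (at x)"
    and bound: "\<And>x. x \<in> I \<Longrightarrow> \<bar>D' x\<bar> \<le> k x * D x"
    and D: "D a = 0" "D b \<ge> 0"
  shows "D b = 0"
proof -
  have K': "(K has_real_derivative k x) (at x within I)" for x
    using K has_field_derivative_at_within by blast
  show ?thesis
  proof (cases "a \<le> b")
    case True
    have "- (D a * exp (- K a)) \<le> - (D b * exp (- K b))"
    proof (rule interval_derivative_mono[OF I True])
      show "((\<lambda>x. - (D x * exp (- K x))) has_real_derivative (k x * D x - D' x) * exp (- K x)) (at x within I)"
        if "x \<in> I" for x
        by (auto intro!: derivative_eq_intros dD that K' simp: algebra_simps)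
      show "0 \<le> (k x * D x - D' x) * exp (- K x)" if "x \<in> I" for x
        using bound[OF that] by simp
    qed
    thus ?thesis using D by (simp add: mult_le_0_iff)
  next
    case False
    have "D b * exp (K b) \<le> D a * exp (K a)"
    proof (rule interval_derivative_mono[OF I(1,3,2)])
      show "((\<lambda>x. D x * exp (K x)) has_real_derivative (k x * D x + D' x) * exp (K x)) (at x within I)"
        if "x \<in> I" for x
        by (auto intro!: derivative_eq_intros dD that K' simp: algebra_simps)
      show "0 \<le> (k x * D x + D' x) * exp (K x)" if "x \<in> I" for x
        using bound[OF that] by simp
    qed (use False in auto)
    thus ?thesis using D by (simp add: mult_le_0_iff)
  qed
qed

subsection \<open>Existence and uniqueness\<close>

context expander_data
begin

text \<open>The clamped equation as a first-order system for \<open>(r, p)\<close>. The thresholds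
  \<open>\<rho> / 2\<close> and \<open>P + 1\<close> leave a gap to the a priori bounds
  \<open>\<rho>\<close> and \<open>P\<close>.\<close>

definition field :: "real \<Rightarrow> real \<times> real \<Rightarrow> real \<times> real" where
  "field t x = (snd x, clamped_rhs m (\<rho> / 2) (P + 1) t (fst x) (snd x))"

lemma P_pos: "0 < P"
  using p0_less_P p0_pos by simp

text \<open>\<open>\<rho>\<close> equals \<open>r0 * exp (- A / m)\<close> with
  \<open>A \<ge> 0\<close>. The proof uses the data alone, since the inequality places
  \<open>h0\<close> in the unclamped region before any curve is available.\<close>

lemma \<rho>_le_r0: "\<rho> \<le> r0"
proof -
  define A where "A = ln (1 + p0\<^sup>2) / 2 + r0 / - (h0 + r0 * p0) * p0"
  have "0 \<le> A" using u0_neg r0_pos p0_pos by (simp add: A_def divide_nonneg_nonpos mult_nonpos_nonneg)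
  hence "- (A - m * ln r0) / m \<le> ln r0" using m_ge by (simp add: field_simps)
  hence "exp (- (A - m * ln r0) / m) \<le> r0" using r0_pos by (simp add: ln_ge_iff)
  thus ?thesis by (simp add: \<rho>_def A_def algebra_simps)
qed

lemma clamped_bounds:
  obtains K where "K > 0"
    "\<And>h r p r' p'. \<bar>clamped_rhs m (\<rho> / 2) (P + 1) h r p - clamped_rhs m (\<rho> / 2) (P + 1) h r' p'\<bar> \<le>
        K * (1 + 3 * h\<^sup>2) * (\<bar>r - r'\<bar> + \<bar>p - p'\<bar>)"
    "\<And>h r p. \<bar>clamped_rhs m (\<rho> / 2) (P + 1) h r p\<bar> \<le> K * (1 + 3 * h\<^sup>2)"
  using clamped_rhs_bounds[of m "\<rho> / 2" "P + 1"] m_ge \<rho>_pos P_pos by auto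

lemma continuous_field: "continuous_on UNIV (\<lambda>(t, x). field t x)"
  unfolding field_def clamped_rhs_def Let_def case_prod_beta
  using \<rho>_pos by (intro continuous_intros) (auto simp: max_def)

lemma clamped_solution:
  obtains r p where "r h0 = r0" "p h0 = p0" "\<And>t. (r has_real_derivative p t) (at t)"
    "\<And>t. (p has_real_derivative clamped_rhs m (\<rho> / 2) (P + 1) t (r t) (p t)) (at t)"
proof -
  obtain K where K: "K > 0"
    "\<And>h r p r' p'. \<bar>clamped_rhs m (\<rho> / 2) (P + 1) h r p - clamped_rhs m (\<rho> / 2) (P + 1) h r' p'\<bar> \<le>
        K * (1 + 3 * h\<^sup>2) * (\<bar>r - r'\<bar> + \<bar>p - p'\<bar>)"
    "\<And>h r p. \<bar>clamped_rhs m (\<rho> / 2) (P + 1) h r p\<bar> \<le> K * (1 + 3 * h\<^sup>2)"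
    by (rule clamped_bounds) (rule that)
  \<comment> \<open>The first component of the field contributes 1, and the second contributes
    \<open>K\<close> times two differences, each at most \<open>norm (x - y)\<close>.
    \<open>L\<close> is the antiderivative vanishing at \<open>h0\<close>.\<close>
  define l where "l t = (2 * K + 1) * (1 + 3 * t\<^sup>2)" for t :: real
  define L where "L t = (2 * K + 1) * ((t + t ^ 3) - (h0 + h0 ^ 3))" for t
  have l_ge: "1 \<le> l t" "K * (1 + 3 * t\<^sup>2) \<le> l t" for t
    using K(1) by (auto simp: l_def algebra_simps)
  have dL: "(L has_real_derivative l t) (at t)" for t
    unfolding L_def l_def by (auto intro!: derivative_eq_intros)
  have L0: "L h0 = 0" by (simp add: L_def)
  have lip: "norm (field t x - field t y) \<le> l t * norm (x - y)" for t x y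
  proof -
    have a: "\<bar>fst x - fst y\<bar> \<le> norm (x - y)" and b: "\<bar>snd x - snd y\<bar> \<le> norm (x - y)"
      using norm_fst_le[of "fst (x - y)" "snd (x - y)"] norm_snd_le[of "snd (x - y)" "fst (x - y)"]
      unfolding prod.collapse by simp_all
    have "norm (field t x - field t y) \<le> \<bar>snd x - snd y\<bar> +
        \<bar>clamped_rhs m (\<rho> / 2) (P + 1) t (fst x) (snd x) - clamped_rhs m (\<rho> / 2) (P + 1) t (fst y) (snd y)\<bar>"
      using norm_Pair_le[of "snd x - snd y" "clamped_rhs m (\<rho> / 2) (P + 1) t (fst x) (snd x) -
        clamped_rhs m (\<rho> / 2) (P + 1) t (fst y) (snd y)"] by (simp add: field_def)
    also have "\<dots> \<le> norm (x - y) + K * (1 + 3 * t\<^sup>2) * (norm (x - y) + norm (x - y))"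
      using K(1) by (intro add_mono order_trans[OF K(2)] mult_left_mono a b) auto
    also have "\<dots> \<le> (1 + 3 * t\<^sup>2) * norm (x - y) + K * (1 + 3 * t\<^sup>2) * (norm (x - y) + norm (x - y))"
      by (simp add: algebra_simps)
    also have "\<dots> = l t * norm (x - y)" by (simp add: l_def algebra_simps)
    finally show ?thesis .
  qed
  have growth: "norm (field t (r0, p0)) \<le> (p0 + 1) * l t" for t
  proof -
    have "norm (field t (r0, p0)) \<le> \<bar>p0\<bar> + \<bar>clamped_rhs m (\<rho> / 2) (P + 1) t r0 p0\<bar>"
      using norm_Pair_le[of p0 "clamped_rhs m (\<rho> / 2) (P + 1) t r0 p0"] by (simp add: field_def)
    also have "\<dots> \<le> p0 * l t + l t"
      using p0_pos l_ge[of t] by (intro add_mono order_trans[OF K(3)]) auto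
    finally show ?thesis by (simp add: algebra_simps)
  qed
  obtain x where x: "x h0 = (r0, p0)" "\<And>t. (x has_vector_derivative field t (x t)) (at t)"
    using Picard_Lindelof_global[OF continuous_field dL L0 lip growth] by blast
  show thesis
  proof (rule that[of "\<lambda>t. fst (x t)" "\<lambda>t. snd (x t)"])
    show "((\<lambda>t. fst (x t)) has_real_derivative snd (x t)) (at t)" for t
      using bounded_linear.has_vector_derivative[OF bounded_linear_fst x(2)[of t]]
      by (simp add: has_real_derivative_iff_has_vector_derivative field_def)
    show "((\<lambda>t. snd (x t)) has_real_derivative
        clamped_rhs m (\<rho> / 2) (P + 1) t (fst (x t)) (snd (x t))) (at t)" for t
      using bounded_linear.has_vector_derivative[OF bounded_linear_snd x(2)[of t]]
      by (simp add: has_real_derivative_iff_has_vector_derivative field_def)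
  qed (simp_all add: x)
qed

text \<open>
  On the component around \<open>h0\<close> of the set where the clamping is inactive, the a priori estimates
  hold; they are strictly stronger than the clamping thresholds, so the component is also closed.
\<close>
lemma entire_curve_exists: "\<exists>r p. expander_curve m h0 r0 p0 UNIV r p"
proof -
  obtain r p where init: "r h0 = r0" "p h0 = p0"
    and dr: "\<And>t. (r has_real_derivative p t) (at t)"
    and dp: "\<And>t. (p has_real_derivative clamped_rhs m (\<rho> / 2) (P + 1) t (r t) (p t)) (at t)"
    using clamped_solution by blast
  have cont: "continuous_on UNIV r" "continuous_on UNIV p"
    using dr dp by (meson DERIV_isCont continuous_at_imp_continuous_on)+
  define S where "S = {t. - 1 < p t \<and> p t < P + 1 \<and> \<rho> / 2 < r t \<and> \<rho> / 2 < r t - t * p t}"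
  define C where "C = connected_component_set S h0"
  have "open S"
    unfolding S_def by (intro open_Collect_conj open_Collect_less continuous_intros cont)
  hence "open C" unfolding C_def by (rule open_connected_component)
  \<comment> \<open>Hence \<open>r - h * p\<close> starts at
    \<open>r0 - h0 * p0 \<ge> r0 \<ge> \<rho>\<close>.\<close>
  have "h0 * p0 \<le> 0" using h0_neg p0_pos by (simp add: mult_nonpos_nonneg)
  hence "h0 \<in> S"
    using init p0_pos p0_less_P \<rho>_le_r0 \<rho>_pos by (auto simp: S_def)
  hence "h0 \<in> C" by (simp add: C_def)
  have "C \<subseteq> S" unfolding C_def by (rule connected_component_subset)
  have curve: "expander_curve m h0 r0 p0 A r p" if "is_interval A" "h0 \<in> A" "A \<subseteq> S" for A
  proof
    fix h assume h: "h \<in> A"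
    hence hS: "h \<in> S" using that by blast
    hence "clamped_rhs m (\<rho> / 2) (P + 1) h (r h) (p h) = expander_rhs m h (r h) (p h)"
      using \<rho>_pos by (intro clamped_rhs_eq) (auto simp: S_def)
    thus "(p has_real_derivative expander_rhs m h (r h) (p h)) (at h within A)"
      using dp[of h] by (simp add: has_field_derivative_at_within)
    show "0 < r h" "0 < r h - h * p h" using hS \<rho>_pos by (auto simp: S_def)
  qed (use that init dr has_field_derivative_at_within in blast)+
  have "is_interval C" by (simp add: C_def is_interval_connected_1)
  from curve[OF this \<open>h0 \<in> C\<close> \<open>C \<subseteq> S\<close>] interpret expander_curve m h0 r0 p0 C r p .
  have "closure C \<subseteq> {t. 0 \<le> p t \<and> p t \<le> P \<and> \<rho> \<le> r t \<and> \<rho> \<le> r t - t * p t}"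
  proof (rule closure_minimal)
    show "C \<subseteq> {t. 0 \<le> p t \<and> p t \<le> P \<and> \<rho> \<le> r t \<and> \<rho> \<le> r t - t * p t}"
      using p_pos p_le_P r_ge_\<rho> w_ge_\<rho> by (auto intro: less_imp_le)
    show "closed {t. 0 \<le> p t \<and> p t \<le> P \<and> \<rho> \<le> r t \<and> \<rho> \<le> r t - t * p t}"
      by (intro closed_Collect_conj closed_Collect_le continuous_intros cont)
  qed
  also have "\<dots> \<subseteq> S" using \<rho>_pos by (auto simp: S_def)
  finally have "closure C \<subseteq> S" .
  moreover have "connected (closure C)"
    unfolding C_def by (intro connected_imp_connected_closure connected_connected_component)
  moreover have "h0 \<in> closure C" using \<open>h0 \<in> C\<close> closure_subset by blast
  ultimately have "closure C \<subseteq> C"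
    unfolding C_def by (intro connected_component_maximal)
  hence "closed C" using closure_subset_eq by blast
  hence "C = UNIV" using \<open>open C\<close> \<open>h0 \<in> C\<close> clopen[of C] by blast
  thus ?thesis using expander_curve_axioms by auto
qed

text \<open>By the a priori estimates both curves solve the clamped equation on all of
  \<open>I\<close>, so one global Lipschitz constant in \<open>(r, p)\<close> for each
  \<open>h\<close> is available and Gronwall's argument applies directly.\<close>

lemma curve_unique:
  assumes "expander_curve m h0 r0 p0 I r p" "expander_curve m h0 r0 p0 I s q" "x \<in> I"
  shows "r x = s x"
proof -
  interpret c1: expander_curve m h0 r0 p0 I r p by fact
  interpret c2: expander_curve m h0 r0 p0 I s q by fact
  obtain K where K: "K > 0"
    "\<And>h r p r' p'. \<bar>clamped_rhs m (\<rho> / 2) (P + 1) h r p - clamped_rhs m (\<rho> / 2) (P + 1) h r' p'\<bar> \<le>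
        K * (1 + 3 * h\<^sup>2) * (\<bar>r - r'\<bar> + \<bar>p - p'\<bar>)"
    by (rule clamped_bounds) (rule that)
  define F where "F h = expander_rhs m h (r h) (p h)" for h
  define G where "G h = expander_rhs m h (s h) (q h)" for h
  have FG: "\<bar>F h - G h\<bar> \<le> K * (1 + 3 * h\<^sup>2) * (\<bar>r h - s h\<bar> + \<bar>p h - q h\<bar>)" if h: "h \<in> I" for h
  proof -
    have "clamped_rhs m (\<rho> / 2) (P + 1) h (r h) (p h) = F h"
      unfolding F_def using c1.p_pos[OF h] c1.p_le_P[OF h] c1.r_ge_\<rho>[OF h] c1.w_ge_\<rho>[OF h] \<rho>_pos
      by (intro clamped_rhs_eq) auto
    moreover have "clamped_rhs m (\<rho> / 2) (P + 1) h (s h) (q h) = G h"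
      unfolding G_def using c2.p_pos[OF h] c2.p_le_P[OF h] c2.r_ge_\<rho>[OF h] c2.w_ge_\<rho>[OF h] \<rho>_pos
      by (intro clamped_rhs_eq) auto
    ultimately show ?thesis using K(2)[of h "r h" "p h" "s h" "q h"] by simp
  qed
  \<comment> \<open>The squared distance is used because it is differentiable. The rate
    \<open>1 + 3 * \<kappa>\<close> comes from estimating the mixed term \<open>2 * a * b\<close> by
    \<open>a^2 + b^2\<close>.\<close>
  have "(r x - s x)\<^sup>2 + (p x - q x)\<^sup>2 = 0"
  proof (rule Gronwall_zero[OF c1.interval c1.h0_in \<open>x \<in> I\<close>,
        where D = "\<lambda>x. (r x - s x)\<^sup>2 + (p x - q x)\<^sup>2"
          and D' = "\<lambda>x. 2 * (r x - s x) * (p x - q x) + 2 * (p x - q x) * (F x - G x)"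
          and K = "\<lambda>x. x + 3 * K * (x + x ^ 3)" and k = "\<lambda>x. 1 + 3 * (K * (1 + 3 * x\<^sup>2))"])
    fix h assume h: "h \<in> I"
    show "((\<lambda>x. (r x - s x)\<^sup>2 + (p x - q x)\<^sup>2) has_real_derivative
        2 * (r h - s h) * (p h - q h) + 2 * (p h - q h) * (F h - G h)) (at h within I)"
      unfolding F_def G_def
      by (auto intro!: derivative_eq_intros c1.dr c2.dr c1.dp c2.dp h simp: algebra_simps)
    define a b \<kappa> where "a = \<bar>r h - s h\<bar>" and "b = \<bar>p h - q h\<bar>" and "\<kappa> = K * (1 + 3 * h\<^sup>2)"
    have \<kappa>: "0 \<le> \<kappa>" using K(1) by (simp add: \<kappa>_def)
    have ab: "2 * (a * b) \<le> a\<^sup>2 + b\<^sup>2" using sum_squares_bound[of a b] by simp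
    have "3 * (a\<^sup>2 + b\<^sup>2) - (2 * (a * b) + 2 * b\<^sup>2) = (a - b)\<^sup>2 + 2 * a\<^sup>2"
      by (simp add: power2_eq_square algebra_simps)
    also have "0 \<le> \<dots>" by simp
    finally have ab': "2 * (a * b) + 2 * b\<^sup>2 \<le> 3 * (a\<^sup>2 + b\<^sup>2)" by simp
    have "\<bar>2 * (r h - s h) * (p h - q h) + 2 * (p h - q h) * (F h - G h)\<bar>
        \<le> 2 * (a * b) + 2 * (b * \<bar>F h - G h\<bar>)"
      by (rule order_trans[OF abs_triangle_ineq]) (simp only: a_def b_def abs_mult mult.assoc abs_numeral order_refl)
    also have "\<dots> \<le> 2 * (a * b) + 2 * (b * (\<kappa> * (a + b)))"
      using FG[OF h] by (intro add_left_mono mult_left_mono) (auto simp: a_def b_def \<kappa>_def)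
    also have "\<dots> = 2 * (a * b) + \<kappa> * (2 * (a * b) + 2 * b\<^sup>2)"
      by (simp add: algebra_simps power2_eq_square)
    also have "\<dots> \<le> (a\<^sup>2 + b\<^sup>2) + \<kappa> * (3 * (a\<^sup>2 + b\<^sup>2))"
      using ab ab' \<kappa> by (intro add_mono mult_left_mono)
    also have "\<dots> = (1 + 3 * \<kappa>) * ((r h - s h)\<^sup>2 + (p h - q h)\<^sup>2)"
      by (simp add: a_def b_def algebra_simps)
    finally show "\<bar>2 * (r h - s h) * (p h - q h) + 2 * (p h - q h) * (F h - G h)\<bar>
        \<le> (1 + 3 * (K * (1 + 3 * h\<^sup>2))) * ((r h - s h)\<^sup>2 + (p h - q h)\<^sup>2)"
      by (simp add: \<kappa>_def)
  next
    show "((\<lambda>x. x + 3 * K * (x + x ^ 3)) has_real_derivative 1 + 3 * (K * (1 + 3 * x\<^sup>2))) (at x)" for x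
      by (auto intro!: derivative_eq_intros)
  qed (simp_all add: c1.r_h0 c1.p_h0 c2.r_h0 c2.p_h0)
  thus ?thesis by (simp add: sum_power2_eq_zero_iff)
qed

end

subsection \<open>Asymptotics\<close>

lemma mono_bounded_tendsto_at_top:
  fixes f :: "real \<Rightarrow> real"
  assumes "mono f" "bdd_above (range f)"
  shows "(f \<longlongrightarrow> (SUP x. f x)) at_top"
proof (rule order_tendstoI)
  fix a assume "a < (SUP x. f x)"
  then obtain x where "a < f x" using less_cSUP_iff[of UNIV f a] assms(2) by auto
  hence "\<forall>y\<ge>x. a < f y" using assms(1) by (meson less_le_trans monoD)
  thus "\<forall>\<^sub>F x in at_top. a < f x" unfolding eventually_at_top_linorder by blast
next
  fix a assume "(SUP x. f x) < a"
  moreover have "f x \<le> (SUP x. f x)" for x using assms(2) by (intro cSUP_upper) auto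
  ultimately show "\<forall>\<^sub>F x in at_top. f x < a" by (intro always_eventually allI) (meson le_less_trans)
qed

lemma mono_bounded_tendsto_at_bot:
  fixes f :: "real \<Rightarrow> real"
  assumes "mono f" "bdd_below (range f)"
  shows "(f \<longlongrightarrow> (INF x. f x)) at_bot"
proof (rule order_tendstoI)
  fix a assume "(INF x. f x) < a"
  then obtain x where "f x < a" using cINF_less_iff[of UNIV f a] assms(2) by auto
  hence "\<forall>y\<le>x. f y < a" using assms(1) by (meson le_less_trans monoD)
  thus "\<forall>\<^sub>F x in at_bot. f x < a" unfolding eventually_at_bot_linorder by blast
next
  fix a assume "a < (INF x. f x)"
  moreover have "(INF x. f x) \<le> f x" for x using assms(2) by (intro cINF_lower) auto
  ultimately show "\<forall>\<^sub>F x in at_bot. a < f x" by (intro always_eventually allI) (meson less_le_trans)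
qed

locale entire_expander_curve = expander_curve m h0 r0 p0 UNIV r p for m h0 r0 p0 r p
begin

lemma dr': "(r has_real_derivative p h) (at h)"
  and dp': "(p has_real_derivative expander_rhs m h (r h) (p h)) (at h)"
  using dr dp by auto

text \<open>
  By concavity \<open>r h \<le> r 1 * h\<close> for \<open>h \<ge> 1\<close>, whence \<open>p / r \<le> - r 1 * p'\<close>,
  i.e. \<open>ln r + r 1 * p\<close> is nonincreasing there.
\<close>
lemma r_bounded_above: "r h \<le> r 1 * exp (r 1 * p 1)"
proof (cases "h \<le> 1")
  case True
  have "r h \<le> r 1 * 1" using r_mono True by simp
  also have "\<dots> \<le> r 1 * exp (r 1 * p 1)" using r_pos[of 1] p_pos[of 1] by (intro mult_left_mono) auto
  finally show ?thesis .
next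
  case False
  hence h: "1 \<le> h" by simp
  have lin: "r x \<le> r 1 * x" if x: "1 \<le> x" for x
  proof -
    have "r 1 * 1 - r 1 \<le> r 1 * x - r x"
    proof (rule interval_derivative_mono[where I = UNIV and f = "\<lambda>x. r 1 * x - r x" and f' = "\<lambda>x. r 1 - p x"])
      show "((\<lambda>x. r 1 * x - r x) has_real_derivative r 1 - p y) (at y within UNIV)" for y
        by (auto intro!: derivative_eq_intros dr')
      \<comment> \<open>Beyond 1 the slope is at most \<open>p 1\<close>, and
        \<open>p 1 < r 1\<close> is positivity of \<open>r - h * p\<close> at
        \<open>h = 1\<close>.\<close>
      show "0 \<le> r 1 - p y" if "1 < y" for y
        using p_antimono[of 1 y] u_pos[of 1] w_pos[of 1] that by simp
    qed (use x in auto)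
    thus ?thesis by simp
  qed
  have "- (ln (r 1) + r 1 * p 1) \<le> - (ln (r h) + r 1 * p h)"
  proof (rule interval_derivative_mono[where I = UNIV and f = "\<lambda>x. - (ln (r x) + r 1 * p x)"
        and f' = "\<lambda>x. - (p x / r x + r 1 * expander_rhs m x (r x) (p x))"])
    show "((\<lambda>x. - (ln (r x) + r 1 * p x)) has_real_derivative
        - (p x / r x + r 1 * expander_rhs m x (r x) (p x))) (at x within UNIV)" for x
      using r_pos[of x] by (auto intro!: derivative_eq_intros dr' dp')
    fix x :: real assume x: "1 < x"
    have pos: "0 < p x" "0 < r x" "0 < r x - x * p x" "0 < r 1" using p_pos r_pos w_pos by simp_all
    \<comment> \<open>Since \<open>u x \<ge> x\<close>, the linear bound on \<open>r\<close>
      compares \<open>r - x * p\<close> with \<open>r 1 * u x\<close>. With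
      \<open>m * (1 + p^2) \<ge> 1\<close> this yields
      \<open>p / r \<le> - r 1 * p'\<close>.\<close>
    have "r x - x * p x \<le> r x" using x pos by simp
    also have "\<dots> \<le> r 1 * x" using lin x by simp
    also have "\<dots> \<le> r 1 * u x" using pos by (simp add: u_def)
    finally have "1 \<le> r 1 * u x / (r x - x * p x)" using pos by simp
    moreover have "1 * 1 \<le> m * (1 + (p x)\<^sup>2)" using m_ge by (intro mult_mono) auto
    ultimately have "1 * 1 \<le> (m * (1 + (p x)\<^sup>2)) * (r 1 * u x / (r x - x * p x))"
      by (intro mult_mono) auto
    hence "p x / r x * 1 \<le> p x / r x * ((m * (1 + (p x)\<^sup>2)) * (r 1 * u x / (r x - x * p x)))"
      using pos by (intro mult_left_mono) auto
    also have "\<dots> = - (r 1 * expander_rhs m x (r x) (p x))"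
      by (simp add: expander_rhs_def u_def mult_ac)
    finally show "0 \<le> - (p x / r x + r 1 * expander_rhs m x (r x) (p x))" by simp
  qed (use h in auto)
  moreover have "0 \<le> r 1 * p h" using r_pos[of 1] p_pos[of h] by simp
  ultimately have "ln (r h) \<le> ln (r 1) + r 1 * p 1" by linarith
  hence "exp (ln (r h)) \<le> exp (ln (r 1) + r 1 * p 1)" by simp
  thus ?thesis using r_pos by (simp add: exp_add)
qed

lemma strict_mono_r: "strict_mono r"
  using r_strict_mono by (simp add: strict_mono_def)

text \<open>The limits are the infimum and supremum of the monotone function \<open>r\<close>, which
  is bounded below by \<open>\<rho>\<close> and above by \<open>r_bounded_above\<close>;
  \<open>r 0 < r 1\<close> separates them.\<close>

lemma limits:
  "\<exists>r_bot r_top. 0 < r_bot \<and> r_bot < r_top \<and> (r \<longlongrightarrow> r_bot) at_bot \<and> (r \<longlongrightarrow> r_top) at_top"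
proof (intro exI conjI)
  have mono: "mono r" using strict_mono_r by (rule strict_mono_mono)
  have above: "bdd_above (range r)" by (rule bdd_aboveI2) (rule r_bounded_above)
  have below: "bdd_below (range r)" by (rule bdd_belowI2) (rule r_ge_\<rho>, simp)
  show "(r \<longlongrightarrow> (INF x. r x)) at_bot" "(r \<longlongrightarrow> (SUP x. r x)) at_top"
    using mono_bounded_tendsto_at_bot mono_bounded_tendsto_at_top mono above below by blast+
  have "\<rho> \<le> (INF x. r x)" using r_ge_\<rho> by (intro cINF_greatest) auto
  thus "0 < (INF x. r x)" using \<rho>_pos by simp
  have "(INF x. r x) \<le> r 0" by (rule cINF_lower[OF below]) simp
  also have "\<dots> < r 1" using r_strict_mono by simp
  also have "\<dots> \<le> (SUP x. r x)" by (rule cSUP_upper[OF _ above]) simp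
  finally show "(INF x. r x) < (SUP x. r x)" .
qed

lemma deriv_deriv_r: "deriv (deriv r) h = expander_rhs m h (r h) (p h)"
proof -
  have "deriv r = p" using dr' DERIV_imp_deriv by blast
  thus ?thesis using DERIV_imp_deriv[OF dp'] by simp
qed

text \<open>\<open>u\<close> is negative at \<open>h0\<close> and positive at 0, so it has a zero in
  between. \<open>u_crossing\<close>, applied on either side of this zero, determines the sign of
  \<open>u\<close> everywhere, and \<open>r''\<close> has the opposite sign.\<close>

lemma inflection:
  "\<exists>h1\<in>{h0<..<0}. deriv (deriv r) h1 = 0 \<and> (\<forall>h. h \<noteq> h1 \<longrightarrow> sgn (deriv (deriv r) h) = sgn (h1 - h))"
proof -
  have "continuous_on {h0..0} u"
    unfolding u_def[abs_def]
    using cont_r cont_p by (intro continuous_intros) (auto intro: continuous_on_subset)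
  then obtain h1 where h1: "h0 \<le> h1" "h1 \<le> 0" "u h1 = 0"
    using IVT'[of u h0 0 0] u_h0 u_pos[of 0] h0_neg by auto
  have "h1 \<noteq> h0" "h1 \<noteq> 0" using h1(3) u_h0 u_pos[of 0] by auto
  moreover have "sgn (deriv (deriv r) h) = sgn (h1 - h)" for h
  proof -
    have "sgn (u h) = sgn (h - h1)"
      using u_crossing[of h h1] u_crossing[of h1 h] h1(3)
      by (cases h h1 rule: linorder_cases) (force simp: sgn_if)+
    thus ?thesis using sgn_p'[of h] by (simp add: deriv_deriv_r sgn_if split: if_splits)
  qed
  moreover from this[of h1] have "deriv (deriv r) h1 = 0" by (simp add: sgn_0_0)
  ultimately show ?thesis using h1 by (intro bexI[of _ h1]) auto
qed

end

section \<open>Passage between the original equation and its normal form, and conclusion\<close>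

lemma expander_equation_iff:
  fixes a p r h m :: real
  assumes "r \<noteq> 0" "r - h * p \<noteq> 0"
  shows "a / (1 + p\<^sup>2) = m * (1 / r - (1 + p\<^sup>2) / (r - h * p)) \<longleftrightarrow> a = expander_rhs m h r p"
proof -
  have pos: "1 + p\<^sup>2 \<noteq> 0" using zero_le_power2[of p] by linarith
  have "1 / r - (1 + p\<^sup>2) / (r - h * p) = ((r - h * p) - r * (1 + p\<^sup>2)) / (r * (r - h * p))"
    by (subst diff_frac_eq[OF assms]) (simp only: mult_1 mult.commute)
  \<comment> \<open>The terms in \<open>r\<close> alone cancel, so the factors \<open>p\<close> and
    \<open>u\<close> split off the numerator.\<close>
  also have "(r - h * p) - r * (1 + p\<^sup>2) = - (p * (h + r * p))"
    by (simp add: algebra_simps power2_eq_square)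
  finally have "expander_rhs m h r p = m * (1 / r - (1 + p\<^sup>2) / (r - h * p)) * (1 + p\<^sup>2)"
    by (simp add: expander_rhs_def mult_ac)
  thus ?thesis using pos by (auto simp: divide_eq_eq)
qed

lemma expander_curve_imp_solution:
  assumes "expander_curve (real n - 1) h0 r0 p0 UNIV r p"
  shows "expander_solution n UNIV r"
proof -
  interpret expander_curve "real n - 1" h0 r0 p0 UNIV r p by fact
  show ?thesis
    unfolding expander_solution_def
  proof (intro conjI exI ballI)
    fix h :: real
    have pos: "0 < r h" "0 < r h - h * p h" using r_pos w_pos by auto
    show "(r has_real_derivative p h) (at h)" "0 < r h" "r h - h * p h \<noteq> 0"
      using pos dr[of h] by auto
    show "(p has_real_derivative expander_rhs (real n - 1) h (r h) (p h)) (at h)"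
      using dp[of h] by simp
    show "expander_rhs (real n - 1) h (r h) (p h) / (1 + (p h)\<^sup>2) =
        (real n - 1) * (1 / r h - (1 + (p h)\<^sup>2) / (r h - h * p h))"
      using expander_equation_iff pos by (metis less_irrefl)
  qed auto
qed

text \<open>The image of the connected set \<open>J\<close> under \<open>r - h * r'\<close> is
  connected, avoids 0 and contains a positive value at \<open>h0\<close>; this fixes the sign that
  \<open>expander_curve\<close> demands.\<close>

lemma (in expander_data) solution_imp_expander_curve:
  assumes sol: "expander_solution n J s" and m: "m = real n - 1"
    and init: "h0 \<in> J" "s h0 = r0" "(s has_real_derivative p0) (at h0 within J)"
  obtains q where "expander_curve m h0 r0 p0 J s q"
proof -
  from sol obtain q q' where J: "is_interval J" "interior J \<noteq> {}"
    and ds: "\<And>h. h \<in> J \<Longrightarrow> (s has_real_derivative q h) (at h within J)"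
    and dq: "\<And>h. h \<in> J \<Longrightarrow> (q has_real_derivative q' h) (at h within J)"
    and pos: "\<And>h. h \<in> J \<Longrightarrow> s h > 0" and w: "\<And>h. h \<in> J \<Longrightarrow> s h - h * q h \<noteq> 0"
    and eq: "\<And>h. h \<in> J \<Longrightarrow> q' h / (1 + (q h)\<^sup>2) = m * (1 / s h - (1 + (q h)\<^sup>2) / (s h - h * q h))"
    unfolding expander_solution_def m by blast
  \<comment> \<open>Uniqueness of the derivative within \<open>J\<close> requires \<open>h0\<close>
    to be a limit point; the nonempty interior excludes \<open>J = {h0}\<close>.\<close>
  have "at h0 within J \<noteq> bot"
  proof -
    have "J \<noteq> {h0}" using J(2) by auto
    hence "h0 islimpt J"
      using connected_imp_perfect[of J h0] J(1) init(1) by (auto simp: is_interval_connected_1)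
    thus ?thesis by (simp add: trivial_limit_within)
  qed
  hence q_h0: "q h0 = p0" using has_field_derivative_unique[OF ds[OF init(1)] init(3)] by simp
  define W where "W h = s h - h * q h" for h
  have contW: "continuous_on J W"
    unfolding W_def
    by (intro continuous_intros DERIV_continuous_on[of J s q] DERIV_continuous_on[of J q q'] ds dq)
  have W_h0: "0 < W h0"
    using init(2) q_h0 r0_pos mult_neg_pos[OF h0_neg p0_pos] by (simp add: W_def)
  have W_pos: "0 < W h" if h: "h \<in> J" for h
  proof (rule ccontr)
    assume "\<not> 0 < W h"
    moreover have "connected (W ` J)"
      using contW J(1) by (intro connected_continuous_image) (auto simp: is_interval_connected_1)
    ultimately have "0 \<in> W ` J"
      using connectedD_interval[of "W ` J" "W h" "W h0" 0] h init(1) W_h0 by auto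
    thus False using w by (auto simp: W_def)
  qed
  have "expander_curve m h0 r0 p0 J s q"
  proof
    fix h assume h: "h \<in> J"
    have "q' h = expander_rhs m h (s h) (q h)"
      using expander_equation_iff[of "s h" h "q h" "q' h" m] eq[OF h] w[OF h] pos[OF h] by simp
    thus "(q has_real_derivative expander_rhs m h (s h) (q h)) (at h within J)" using dq[OF h] by simp
    show "0 < s h - h * q h" using W_pos[OF h] by (simp add: W_def)
  qed (use J(1) init q_h0 ds pos in auto)
  thus thesis by (rule that)
qed

theorem theorem15:
  fixes n :: nat and r0 h0 r0' :: real
  assumes "n \<ge> 2" and "r0 > 0" and "h0 < 0" and "r0' \<in> {0<..<- h0 / r0}"
  shows "\<exists>r. maximal_expander_ivp n h0 r0 r0' UNIV r \<and>
    (\<forall>J s. maximal_expander_ivp n h0 r0 r0' J s \<longrightarrow> J = UNIV \<and> s = r) \<and>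
    (\<exists>r_bot r_top. 0 < r_bot \<and> r_bot < r_top \<and>
       strict_mono r \<and>
       (r \<longlongrightarrow> r_bot) at_bot \<and>
       (r \<longlongrightarrow> r_top) at_top \<and>
       (\<exists>h1\<in>{h0<..<0}. deriv (deriv r) h1 = 0 \<and>
          (\<forall>h. h \<noteq> h1 \<longrightarrow> sgn (deriv (deriv r) h) = sgn (h1 - h))))"
proof -
  interpret expander_data "real n - 1" h0 r0 r0'
    using assms by unfold_locales (auto simp: field_simps)
  obtain r p where curve: "expander_curve (real n - 1) h0 r0 r0' UNIV r p"
    using entire_curve_exists by blast
  then interpret entire_expander_curve "real n - 1" h0 r0 r0' r p
    by (simp add: entire_expander_curve_def)
  have sol: "expander_solution n UNIV r" by (rule expander_curve_imp_solution[OF curve])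
  have ivp: "maximal_expander_ivp n h0 r0 r0' UNIV r"
    unfolding maximal_expander_ivp_def maximal_expander_solution_def
    using sol r_h0 dr'[of h0] p_h0 by auto
  have unique: "J = UNIV \<and> s = r" if s: "maximal_expander_ivp n h0 r0 r0' J s" for J s
  proof -
    from s have s': "expander_solution n J s" "h0 \<in> J" "s h0 = r0"
      "(s has_real_derivative r0') (at h0 within J)"
      and max: "\<And>K t. expander_solution n K t \<Longrightarrow> J \<subseteq> K \<Longrightarrow> \<forall>h\<in>J. t h = s h \<Longrightarrow> K = J"
      unfolding maximal_expander_ivp_def maximal_expander_solution_def by blast+
    obtain q where q: "expander_curve (real n - 1) h0 r0 r0' J s q"
      using solution_imp_expander_curve[OF s'(1) refl s'(2-4)] by blast
    \<comment> \<open>The entire curve restricted to \<open>J\<close> agrees with \<open>s\<close>,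
      so \<open>r\<close> extends \<open>s\<close>, and maximality of \<open>s\<close> forces
      \<open>J = UNIV\<close>.\<close>
    have "expander_curve (real n - 1) h0 r0 r0' J r p"
    proof
      show "is_interval J" using q by (rule expander_curve.interval)
      fix h assume "h \<in> J"
      show "(r has_real_derivative p h) (at h within J)"
        using dr' by (rule has_field_derivative_at_within)
      show "(p has_real_derivative expander_rhs (real n - 1) h (r h) (p h)) (at h within J)"
        using dp' by (rule has_field_derivative_at_within)
    qed (use s'(2) r_h0 p_h0 r_pos w_pos in auto)
    hence eq: "r h = s h" if "h \<in> J" for h
      using curve_unique[OF _ q that] by blast
    hence "J = UNIV" using max[OF sol] by auto
    thus ?thesis using eq by auto
  qed
  show ?thesis
    using ivp unique limits strict_mono_r inflection by blast
qed

end
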